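(* For $n\ge1$ let $a(n,j)$ (resp. $\bar a(n,j)$) be the number of permutations in $\mathfrak{S}_n$ with $j$ descents at odd positions and no descents (resp. no ascents) at even positions, so that $A_n(x,0)=\sum_{j=0}^{\lfloor n/2\rfloor}a(n,j)x^j$ and $\widehat{A}_n(x,0)=\sum_{j=0}^{\lfloor n/2\rfloor}\bar a(n,j)x^j$. Then $$\widetilde{A}_n(x,y)=\sum_{j=0}^{\lfloor n/2\rfloor}a(n,j)\,(x+y)^j(1+xy)^{\lfloor n/2\rfloor-j},\qquad \overline{A}_n(x,y)=\sum_{j=0}^{\lfloor n/2\rfloor}\bar a(n,j)\,(x+y)^j(1+xy)^{\lfloor n/2\rfloor-j}.$$ Moreover, $\bar a(n,j)=a(n,\lfloor n/2\rfloor-j)$ for $0\le j\le\lfloor n/2\rfloor$.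
   Context: For $\sigma\in\mathfrak{S}_n$, a position $i\in[n-1]$ is a descent if $\sigma(i)>\sigma(i+1)$ and an ascent if $\sigma(i)<\sigma(i+1)$. $\mathrm{des}_1\sigma$ (resp. $\mathrm{des}_0\sigma$) is the number of descents at odd (resp. even) positions, and $\mathrm{asc}_0\sigma$ the number of ascents at even positions. $A_n(x,y)=\sum_{\sigma\in\mathfrak{S}_n}x^{\mathrm{des}_1\sigma}y^{\mathrm{des}_0\sigma}$ and $\widehat{A}_n(x,y)=\sum_{\sigma\in\mathfrak{S}_n}x^{\mathrm{des}_1\sigma}y^{\mathrm{asc}_0\sigma}$. For $m\ge1$: $\widetilde{A}_{2m}(x,y)=(1+y)A_{2m}(x,y)$, $\widetilde{A}_{2m-1}(x,y)=A_{2m-1}(x,y)$, $\overline{A}_{2m}(x,y)=(1+y)\widehat{A}_{2m}(x,y)$, $\overline{A}_{2m-1}(x,y)=\widehat{A}_{2m-1}(x,y)$. *)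

theory Defs
  imports Main "HOL-Combinatorics.Permutations"
begin

definition des1 :: "nat \<Rightarrow> (nat \<Rightarrow> nat) \<Rightarrow> nat" where
  "des1 n \<sigma> = card {i \<in> {1..<n}. odd i \<and> \<sigma> i > \<sigma> (i + 1)}"

definition des0 :: "nat \<Rightarrow> (nat \<Rightarrow> nat) \<Rightarrow> nat" where
  "des0 n \<sigma> = card {i \<in> {1..<n}. even i \<and> \<sigma> i > \<sigma> (i + 1)}"

definition asc0 :: "nat \<Rightarrow> (nat \<Rightarrow> nat) \<Rightarrow> nat" where
  "asc0 n \<sigma> = card {i \<in> {1..<n}. even i \<and> \<sigma> i < \<sigma> (i + 1)}"

text \<open>
  The bivariate polynomials are represented by their evaluations at points of an arbitrary
  commutative ring; taking the ring to be \<open>int poly poly\<close> and the two points to be its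
  indeterminates recovers identities of formal polynomials.
\<close>

definition A_poly :: "nat \<Rightarrow> 'a::comm_ring_1 \<Rightarrow> 'a \<Rightarrow> 'a" where
  "A_poly n x y = (\<Sum>\<sigma> | \<sigma> permutes {1..n}. x ^ des1 n \<sigma> * y ^ des0 n \<sigma>)"

definition A_hat :: "nat \<Rightarrow> 'a::comm_ring_1 \<Rightarrow> 'a \<Rightarrow> 'a" where
  "A_hat n x y = (\<Sum>\<sigma> | \<sigma> permutes {1..n}. x ^ des1 n \<sigma> * y ^ asc0 n \<sigma>)"

definition A_tilde :: "nat \<Rightarrow> 'a::comm_ring_1 \<Rightarrow> 'a \<Rightarrow> 'a" where
  "A_tilde n x y = (if even n then (1 + y) * A_poly n x y else A_poly n x y)"

definition A_bar :: "nat \<Rightarrow> 'a::comm_ring_1 \<Rightarrow> 'a \<Rightarrow> 'a" where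
  "A_bar n x y = (if even n then (1 + y) * A_hat n x y else A_hat n x y)"

definition a_num :: "nat \<Rightarrow> nat \<Rightarrow> nat" where
  "a_num n j = card {\<sigma>. \<sigma> permutes {1..n} \<and> des1 n \<sigma> = j \<and> des0 n \<sigma> = 0}"

definition a_bar_num :: "nat \<Rightarrow> nat \<Rightarrow> nat" where
  "a_bar_num n j = card {\<sigma>. \<sigma> permutes {1..n} \<and> des1 n \<sigma> = j \<and> asc0 n \<sigma> = 0}"

end

theory Submission
  imports Defs "HOL-Combinatorics.Multiset_Permutations" "HOL-Computational_Algebra.Polynomial"
begin

text \<open>
  Give every position \<open>i\<close> a weight \<open>f i True\<close> for a descent and \<open>f i False\<close> for an ascent. Splitting
  a word at the first of its two extreme letters, and adding the contributions of the minimum and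
  the maximum, yields the recursion of the cd-index of the Boolean algebra: the weights only enter
  through \<open>c = f i True + f i False\<close> and
  \<open>d = f i False * f (i + 1) True + f i True * f (i + 1) False\<close>. The weights \<open>(x, 1)\<close> at odd and
  \<open>(y, 1)\<close> at even positions turn \<open>d\<close> into \<open>s = x + y\<close> and a product of two neighbouring \<open>c\<close> into
  \<open>(1 + x) (1 + y) = s + t\<close>, where \<open>t = 1 + x y\<close>; the weights \<open>(1, y)\<close> at even positions exchange \<open>s\<close>
  and \<open>t\<close>. So both sums are values of one homogeneous polynomial in \<open>s\<close> and \<open>t\<close>, whose coefficients
  are found by putting \<open>y = 0\<close>.
\<close>

section \<open>Words split at the first letter of a given set\<close>

lemma bij_betw_permutations_of_set_split_first:
  assumes "X \<subseteq> S" "X \<noteq> {}"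
  shows "bij_betw (\<lambda>(x, T, l, r). l @ x # r)
    (SIGMA x:X. SIGMA T:Pow (S - X). permutations_of_set T \<times> permutations_of_set (S - {x} - T))
    (permutations_of_set S)" (is "bij_betw ?join ?D _")
proof (rule bij_betw_imageI)
  show "inj_on ?join ?D"
  proof (rule inj_onI, clarsimp)
    fix x T l r x' T' l' r'
    assume "x \<in> X" "T \<subseteq> S - X" "l \<in> permutations_of_set T" "r \<in> permutations_of_set (S - {x} - T)"
      and "x' \<in> X" "T' \<subseteq> S - X" "l' \<in> permutations_of_set T'"
        "r' \<in> permutations_of_set (S - {x'} - T')"
      and words: "l @ x # r = l' @ x' # r'"
    then have sets: "x \<in> X" "x' \<in> X" "set l \<inter> X = {}" "set l' \<inter> X = {}" "set l = T" "set l' = T'"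
      by (auto dest: permutations_of_setD)
    have "l = takeWhile (\<lambda>y. y \<notin> X) (l @ x # r)" "l' = takeWhile (\<lambda>y. y \<notin> X) (l' @ x' # r')"
      using sets by (auto simp: takeWhile_append)
    with words have "l = l'" by simp
    with words sets show "x = x' \<and> T = T' \<and> l = l' \<and> r = r'" by auto
  qed
  show "?join ` ?D = permutations_of_set S"
  proof (intro equalityI subsetI)
    fix w assume w: "w \<in> permutations_of_set S"
    then have "\<exists>x\<in>set w. x \<in> X"
      using assms by (auto dest: permutations_of_setD)
    then obtain l x r where split: "w = l @ x # r" "x \<in> X" "\<forall>y\<in>set l. y \<notin> X"
      using split_list_first_prop[of w "\<lambda>x. x \<in> X"] by blast
    then have "(x, set l, l, r) \<in> ?D"
      using permutations_of_setD[OF w] by (auto intro!: permutations_of_setI)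
    then show "w \<in> ?join ` ?D"
      unfolding split(1) by (rule rev_image_eqI) simp
  qed (use assms in \<open>auto simp: permutations_of_set_def\<close>)
qed

lemma sum_permutations_of_set_split_first:
  assumes "finite S" "X \<subseteq> S" "X \<noteq> {}"
  shows "(\<Sum>w\<in>permutations_of_set S. h w) = (\<Sum>x\<in>X. \<Sum>T\<in>Pow (S - X).
    \<Sum>l\<in>permutations_of_set T. \<Sum>r\<in>permutations_of_set (S - {x} - T). h (l @ x # r))"
proof -
  note split_bij = bij_betw_permutations_of_set_split_first[OF assms(2,3)]
  have "finite X" using assms finite_subset by blast
  then show ?thesis
    using assms(1) by (subst sum.reindex_bij_betw[OF split_bij, symmetric])
      (simp add: sum.Sigma split_beta)
qed

section \<open>Descent words with position-dependent weights\<close>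

fun descent_weight :: "(nat \<Rightarrow> bool \<Rightarrow> 'a::semiring_1) \<Rightarrow> nat \<Rightarrow> 'b::linorder list \<Rightarrow> 'a" where
  "descent_weight f i (x # y # w) = f i (x > y) * descent_weight f (Suc i) (y # w)"
| "descent_weight f i _ = 1"

definition descent_sum :: "(nat \<Rightarrow> bool \<Rightarrow> 'a::semiring_1) \<Rightarrow> nat \<Rightarrow> nat \<Rightarrow> 'a" where
  "descent_sum f i n = (\<Sum>w\<in>permutations_of_set {..<n}. descent_weight f i w)"

lemma descent_weight_map_strict_mono_on:
  "strict_mono_on (set w) g \<Longrightarrow> descent_weight f i (map g w) = descent_weight f i w"
proof (induction f i w rule: descent_weight.induct)
  case (1 f i x y w)
  then have "strict_mono_on (set (y # w)) g" and "g x > g y \<longleftrightarrow> x > y"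
    by (auto simp: strict_mono_on_less intro: monotone_on_subset)
  with 1 show ?case by simp
qed simp_all

lemma sum_descent_weight_permutations_of_set:
  fixes S :: "'b::linorder set"
  assumes "finite S"
  shows "(\<Sum>w\<in>permutations_of_set S. descent_weight f i w) = descent_sum f i (card S)"
proof -
  define g where "g = nth (sorted_list_of_set S)"
  have bij: "bij_betw g {..<card S} S"
    unfolding g_def using assms by (intro bij_betw_nth) simp_all
  have mono: "strict_mono_on {..<card S} g"
    unfolding g_def
    by (intro strict_mono_onI sorted_wrt_nth_less[OF strict_sorted_list_of_set]) simp_all
  have "permutations_of_set S = map g ` permutations_of_set {..<card S}"
    using bij permutations_of_set_image_inj by (metis bij_betw_def)
  moreover have "inj_on (map g) (permutations_of_set {..<card S})"
    using bij by (intro inj_on_mapI) (auto simp: bij_betw_def dest: permutations_of_setD)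
  ultimately show ?thesis
    unfolding descent_sum_def using mono
    by (simp add: sum.reindex descent_weight_map_strict_mono_on permutations_of_setD(1)
        cong: sum.cong)
qed

lemma descent_weight_upt:
  fixes f :: "nat \<Rightarrow> bool \<Rightarrow> 'a::comm_semiring_1" and g :: "nat \<Rightarrow> 'b::linorder"
  shows "descent_weight f i (map g [i..<Suc j]) = (\<Prod>k\<in>{i..<j}. f k (g k > g (Suc k)))"
proof (induction "j - i" arbitrary: i)
  case 0
  then show ?case by (cases "i = j") auto
next
  case (Suc n)
  then have "i < j" "n = j - Suc i" by auto
  then have "[i..<Suc j] = i # Suc i # [Suc (Suc i)..<Suc j]"
    and "map g [Suc i..<Suc j] = g (Suc i) # map g [Suc (Suc i)..<Suc j]"
    by (simp_all add: upt_conv_Cons del: upt_Suc)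
  with Suc.hyps(1)[of "Suc i"] \<open>i < j\<close> \<open>n = j - Suc i\<close> show ?case
    by (simp add: prod.atLeast_Suc_lessThan del: upt_Suc)
qed

lemma bij_betw_permutes_permutations_of_set:
  assumes "distinct xs"
  shows "bij_betw (\<lambda>\<sigma>. map \<sigma> xs) {\<sigma>. \<sigma> permutes set xs} (permutations_of_set (set xs))"
proof (rule bij_betw_imageI)
  show inj: "inj_on (\<lambda>\<sigma>. map \<sigma> xs) {\<sigma>. \<sigma> permutes set xs}"
    by (rule inj_onI) (metis map_eq_conv mem_Collect_eq permutes_not_in ext)
  have "(\<lambda>\<sigma>. map \<sigma> xs) ` {\<sigma>. \<sigma> permutes set xs} \<subseteq> permutations_of_set (set xs)"
    using assms by (auto intro!: permutations_of_setI
        simp: permutes_image distinct_map permutes_inj_on permutes_in_image)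
  then show "(\<lambda>\<sigma>. map \<sigma> xs) ` {\<sigma>. \<sigma> permutes set xs} = permutations_of_set (set xs)"
    by (intro card_subset_eq) (simp_all add: card_image[OF inj] card_permutations[OF refl])
qed

theorem sum_permutes_prod_descent:
  fixes f :: "nat \<Rightarrow> bool \<Rightarrow> 'a::comm_semiring_1"
  shows "(\<Sum>\<sigma> | \<sigma> permutes {1..n}. \<Prod>i\<in>{1..<n}. f i (\<sigma> i > \<sigma> (Suc i))) = descent_sum f 1 n"
proof -
  have "(\<Sum>\<sigma> | \<sigma> permutes {1..n}. \<Prod>i\<in>{1..<n}. f i (\<sigma> i > \<sigma> (Suc i)))
      = (\<Sum>\<sigma> | \<sigma> permutes set [1..<Suc n]. descent_weight f 1 (map \<sigma> [1..<Suc n]))"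
    by (simp only: descent_weight_upt set_upt atLeastLessThanSuc_atLeastAtMost)
  also have "\<dots> = (\<Sum>w\<in>permutations_of_set (set [1..<Suc n]). descent_weight f 1 w)"
    by (rule sum.reindex_bij_betw[OF bij_betw_permutes_permutations_of_set]) simp
  also have "\<dots> = descent_sum f 1 n"
    by (simp add: sum_descent_weight_permutations_of_set del: upt_Suc)
  finally show ?thesis .
qed

lemma descent_weight_append_Cons:
  "descent_weight f i (l @ x # r)
    = descent_weight f i (l @ [x]) * descent_weight f (i + length l) (x # r)"
  by (induction f i l rule: descent_weight.induct) (simp_all add: mult.assoc)

lemma descent_weight_Cons_extremum:
  assumes "r \<noteq> []" "\<forall>y\<in>set r. (x > y) = \<delta>"
  shows "descent_weight f i (x # r) = f i \<delta> * descent_weight f (Suc i) r"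
  using assms by (cases r) auto

lemma descent_weight_snoc_extremum:
  assumes "\<forall>y\<in>set l. (y > x) = \<delta>"
  shows "descent_weight f i (l @ [x])
    = (case length l of 0 \<Rightarrow> 1 | Suc k \<Rightarrow> descent_weight f i l * f (i + k) \<delta>)"
  using assms
  by (induction f i l rule: descent_weight.induct) (simp_all add: mult.assoc)

text \<open>
  Words with \<open>m\<close> letters before and \<open>n\<close> letters after a fixed maximum (\<open>\<delta> = True\<close>) or minimum
  (\<open>\<delta> = False\<close>). The definition is only meaningful for \<open>n > 0\<close>: a last letter is neither a descent
  nor an ascent.
\<close>

definition extremal_pivot_sum ::
  "(nat \<Rightarrow> bool \<Rightarrow> 'a::semiring_1) \<Rightarrow> bool \<Rightarrow> nat \<Rightarrow> nat \<Rightarrow> nat \<Rightarrow> 'a" where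
  "extremal_pivot_sum f \<delta> i m n =
    (case m of 0 \<Rightarrow> 1 | Suc k \<Rightarrow> descent_sum f i m * f (i + k) (\<not> \<delta>))
    * (f (i + m) \<delta> * descent_sum f (Suc (i + m)) n)"

lemma sum_descent_weight_extremum:
  fixes f :: "nat \<Rightarrow> bool \<Rightarrow> 'a::semiring_1" and x :: "'b::linorder"
  assumes "finite T" "finite U" "U \<noteq> {}"
    and "\<forall>y\<in>T. (y > x) = (\<not> \<delta>)" "\<forall>y\<in>U. (x > y) = \<delta>"
  shows "(\<Sum>l\<in>permutations_of_set T. \<Sum>r\<in>permutations_of_set U. descent_weight f i (l @ x # r))
    = extremal_pivot_sum f \<delta> i (card T) (card U)"
proof -
  define left_weight right_weight where
    "left_weight l = (case card T of 0 \<Rightarrow> 1 | Suc k \<Rightarrow> descent_weight f i l * f (i + k) (\<not> \<delta>))"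
    and "right_weight r = f (i + card T) \<delta> * descent_weight f (Suc (i + card T)) r"
    for l r :: "'b list"
  have "descent_weight f i (l @ x # r) = left_weight l * right_weight r"
    if "l \<in> permutations_of_set T" "r \<in> permutations_of_set U" for l r
  proof -
    have "set l = T" "set r = U" "length l = card T"
      using that by (auto dest: permutations_of_setD length_finite_permutations_of_set)
    with assms have right: "r \<noteq> []" "\<forall>y\<in>set r. (x > y) = \<delta>"
      and left: "\<forall>y\<in>set l. (y > x) = (\<not> \<delta>)"
      by auto
    show ?thesis
      unfolding left_weight_def right_weight_def descent_weight_append_Cons[of f i l x r]
        descent_weight_snoc_extremum[OF left] descent_weight_Cons_extremum[OF right]
        \<open>length l = card T\<close> ..
  qed
  then have "(\<Sum>l\<in>permutations_of_set T. \<Sum>r\<in>permutations_of_set U. descent_weight f i (l @ x # r))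
      = sum left_weight (permutations_of_set T) * sum right_weight (permutations_of_set U)"
    by (simp add: sum_product cong: sum.cong)
  moreover have "sum left_weight (permutations_of_set T)
      = (case card T of 0 \<Rightarrow> 1 | Suc k \<Rightarrow> descent_sum f i (card T) * f (i + k) (\<not> \<delta>))"
    unfolding left_weight_def
    using \<open>finite T\<close> sum_descent_weight_permutations_of_set[OF \<open>finite T\<close>, of f i]
    by (cases "card T") (simp_all flip: sum_distrib_right)
  moreover have "sum right_weight (permutations_of_set U)
      = f (i + card T) \<delta> * descent_sum f (Suc (i + card T)) (card U)"
    unfolding right_weight_def
    by (simp add: sum_descent_weight_permutations_of_set[OF \<open>finite U\<close>] flip: sum_distrib_left)
  ultimately show ?thesis
    by (simp only: extremal_pivot_sum_def)
qed

lemma sum_descent_weight_min_max_pivot: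
  assumes "x \<in> {0, Suc n}" "T \<subseteq> {..<Suc (Suc n)} - {0, Suc n}"
  shows "(\<Sum>l\<in>permutations_of_set T. \<Sum>r\<in>permutations_of_set ({..<Suc (Suc n)} - {x} - T).
      descent_weight f i (l @ x # r))
    = extremal_pivot_sum f (x = Suc n) i (card T) (Suc n - card T)"
proof -
  let ?U = "{..<Suc (Suc n)} - {x} - T"
  have "finite T" "T \<subseteq> {..<Suc (Suc n)} - {x}" "Suc n - x \<in> ?U"
    using assms by (auto intro: finite_subset)
  moreover from this have "card ?U = Suc n - card T"
    using assms by (subst card_Diff_subset) auto
  moreover have "\<forall>y\<in>T. (y > x) = (x \<noteq> Suc n)" "\<forall>y\<in>?U. (x > y) = (x = Suc n)"
    using assms by auto
  ultimately show ?thesis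
    by (subst sum_descent_weight_extremum) auto
qed

lemma sum_Pow_card:
  fixes g :: "nat \<Rightarrow> 'a::semiring_1"
  assumes "finite S"
  shows "(\<Sum>T\<in>Pow S. g (card T)) = (\<Sum>k\<le>card S. of_nat (card S choose k) * g k)"
proof -
  have "(\<Sum>T\<in>Pow S. g (card T)) = (\<Sum>k\<le>card S. \<Sum>T | T \<in> Pow S \<and> card T = k. g (card T))"
    using assms by (intro sum.group[symmetric]) (auto intro: card_mono)
  also have "\<dots> = (\<Sum>k\<le>card S. of_nat (card S choose k) * g k)"
    by (intro sum.cong) (auto simp: n_subsets[OF assms, symmetric])
  finally show ?thesis .
qed

theorem descent_sum_Suc_Suc:
  fixes f :: "nat \<Rightarrow> bool \<Rightarrow> 'a::semiring_1"
  shows "descent_sum f i (Suc (Suc n)) =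
    (f i True + f i False) * descent_sum f (Suc i) (Suc n)
    + (\<Sum>k<n. of_nat (n choose Suc k) * (descent_sum f i (Suc k)
        * (f (i + k) False * f (Suc (i + k)) True + f (i + k) True * f (Suc (i + k)) False)
        * descent_sum f (Suc (Suc (i + k))) (n - k)))"
proof -
  let ?inner = "{..<Suc (Suc n)} - {0, Suc n}"
  let ?pivot_sum = "\<lambda>\<delta> k. extremal_pivot_sum f \<delta> i k (Suc n - k)"
  have card_inner: "card ?inner = n" by (subst card_Diff_subset) auto
  have "descent_sum f i (Suc (Suc n)) = (\<Sum>x\<in>{0, Suc n}. \<Sum>T\<in>Pow ?inner.
      \<Sum>l\<in>permutations_of_set T. \<Sum>r\<in>permutations_of_set ({..<Suc (Suc n)} - {x} - T).
        descent_weight f i (l @ x # r))"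
    unfolding descent_sum_def by (rule sum_permutations_of_set_split_first) auto
  also have "\<dots> = (\<Sum>x\<in>{0, Suc n}. \<Sum>T\<in>Pow ?inner. ?pivot_sum (x = Suc n) (card T))"
    by (intro sum.cong refl sum_descent_weight_min_max_pivot) simp_all
  also have "\<dots> = (\<Sum>k\<le>n. of_nat (n choose k) * (?pivot_sum True k + ?pivot_sum False k))"
    by (subst sum_Pow_card) (simp_all add: card_inner sum.distrib distrib_left add.commute)
  also have "\<dots> = ?pivot_sum True 0 + ?pivot_sum False 0 + (\<Sum>k<n. of_nat (n choose Suc k)
      * (?pivot_sum True (Suc k) + ?pivot_sum False (Suc k)))"
    by (simp add: sum.atMost_shift)
  finally show ?thesis
    by (simp add: extremal_pivot_sum_def distrib_left distrib_right mult.assoc)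
qed

section \<open>Alternating weights\<close>

text \<open>
  For odd \<open>n\<close> this is the value of the cd-index of the Boolean algebra of rank \<open>n\<close>, where \<open>q\<close> stands
  for the square of the letter c; for even \<open>n > 0\<close> the unpaired letter c is removed.
\<close>

fun paired_cd_index :: "'a::comm_semiring_1 \<Rightarrow> 'a \<Rightarrow> nat \<Rightarrow> 'a" where
  "paired_cd_index q d 0 = 1"
| "paired_cd_index q d (Suc 0) = 1"
| "paired_cd_index q d (Suc (Suc n)) = (if odd n then q else 1) * paired_cd_index q d (Suc n)
    + (\<Sum>k<n. of_nat (n choose Suc k) * (if odd n \<and> odd k then q else 1)
        * paired_cd_index q d (Suc k) * d * paired_cd_index q d (n - k))"

theorem descent_sum_alternating:
  fixes f :: "nat \<Rightarrow> bool \<Rightarrow> 'a::comm_semiring_1"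
  assumes weight_sum: "\<And>i. f i True + f i False = (if odd i then c\<^sub>1 else c\<^sub>0)"
    and peak_valley_sum: "\<And>i. f i False * f (Suc i) True + f i True * f (Suc i) False = d"
    and "n > 0"
  shows "descent_sum f i n
    = (if odd n then 1 else if odd i then c\<^sub>1 else c\<^sub>0) * paired_cd_index (c\<^sub>1 * c\<^sub>0) d n"
  using \<open>n > 0\<close>
proof (induction n arbitrary: i rule: less_induct)
  case (less n)
  let ?c = "\<lambda>n i. if odd n then 1 else if odd i then c\<^sub>1 else c\<^sub>0"
    and ?\<Phi> = "paired_cd_index (c\<^sub>1 * c\<^sub>0) d"
  consider (one) "n = 1" | (Suc_Suc) m where "n = Suc (Suc m)"
    using less.prems by (metis One_nat_def gr0_conv_Suc not0_implies_Suc)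
  then show ?case
  proof cases
    case one
    have "{..<Suc 0} = {0}" by auto
    with one show ?thesis by (simp add: descent_sum_def)
  next
    case Suc_Suc
    have "?c 2 i * ?c (Suc m) (Suc i) = ?c n i * (if odd m then c\<^sub>1 * c\<^sub>0 else 1)"
      using Suc_Suc by (simp add: mult_ac)
    then have initial_term: "(f i True + f i False) * descent_sum f (Suc i) (Suc m)
        = ?c n i * ((if odd m then c\<^sub>1 * c\<^sub>0 else 1) * ?\<Phi> (Suc m))"
      using less.IH[of "Suc m" "Suc i"] Suc_Suc by (simp add: weight_sum mult_ac)
    have split_term: "descent_sum f i (Suc k) * d * descent_sum f (Suc (Suc (i + k))) (m - k)
        = ?c n i * ((if odd m \<and> odd k then c\<^sub>1 * c\<^sub>0 else 1) * ?\<Phi> (Suc k) * d * ?\<Phi> (m - k))"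
      if "k < m" for k
    proof -
      have "?c (Suc k) i * ?c (m - k) (Suc (Suc (i + k)))
          = ?c n i * (if odd m \<and> odd k then c\<^sub>1 * c\<^sub>0 else 1)"
        using that Suc_Suc by (auto simp: mult_ac)
      then show ?thesis
        using less.IH[of "Suc k" i] less.IH[of "m - k" "Suc (Suc (i + k))"] that Suc_Suc
        by (simp add: mult_ac)
    qed
    show ?thesis
      unfolding Suc_Suc descent_sum_Suc_Suc peak_valley_sum initial_term paired_cd_index.simps
      using split_term Suc_Suc
      by (simp add: sum_distrib_left distrib_left mult.left_commute mult.assoc)
  qed
qed

lemma prod_alternating_weights:
  fixes x c d :: "'a::comm_semiring_1"
  assumes "\<sigma> permutes {1..n}"
  shows "(\<Prod>i\<in>{1..<n}. if odd i then (if \<sigma> i > \<sigma> (Suc i) then x else 1)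
      else (if \<sigma> i > \<sigma> (Suc i) then c else d))
    = x ^ des1 n \<sigma> * c ^ des0 n \<sigma> * d ^ asc0 n \<sigma>"
proof -
  have power_card: "z ^ card {i \<in> {1..<n}. P i} = (\<Prod>i\<in>{1..<n}. if P i then z else 1)"
    for z :: 'a and P
    by (simp flip: prod.inter_filter)
  have ascent: "\<sigma> i < \<sigma> (Suc i) \<longleftrightarrow> \<not> \<sigma> i > \<sigma> (Suc i)" for i
    using permutes_inj[OF assms] by (metis inj_eq n_not_Suc_n not_less_iff_gr_or_eq)
  show ?thesis
    unfolding des1_def des0_def asc0_def power_card prod.distrib[symmetric]
    by (intro prod.cong refl) (auto simp: ascent)
qed

lemma sum_permutes_alternating:
  fixes x c d :: "'a::comm_semiring_1"
  assumes "n \<ge> 1"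
  shows "(\<Sum>\<sigma> | \<sigma> permutes {1..n}. x ^ des1 n \<sigma> * c ^ des0 n \<sigma> * d ^ asc0 n \<sigma>)
    = (if odd n then 1 else x + 1) * paired_cd_index ((x + 1) * (c + d)) (x * d + c) n"
proof -
  let ?f = "\<lambda>i \<delta>. if odd i then (if \<delta> then x else 1) else (if \<delta> then c else d)"
  have "(\<Sum>\<sigma> | \<sigma> permutes {1..n}. x ^ des1 n \<sigma> * c ^ des0 n \<sigma> * d ^ asc0 n \<sigma>) = descent_sum ?f 1 n"
    unfolding sum_permutes_prod_descent[symmetric]
    by (intro sum.cong refl prod_alternating_weights[symmetric]) simp
  also have "\<dots> = (if odd n then 1 else x + 1) * paired_cd_index ((x + 1) * (c + d)) (x * d + c) n"
    using assms by (subst descent_sum_alternating[where c\<^sub>1 = "x + 1" and c\<^sub>0 = "c + d"])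
      (auto simp: mult.commute add.commute)
  finally show ?thesis .
qed

section \<open>Homogeneous polynomials in two variables\<close>

text \<open>
  The polynomial \<open>p\<close> encodes the homogeneous polynomial of degree \<open>m\<close> in two variables that becomes
  \<open>p\<close> when its second variable is set to 1, and \<open>u\<close> is the value of the latter at \<open>(s, t)\<close>.
\<close>

definition homogeneous_value :: "'a::comm_ring_1 \<Rightarrow> 'a \<Rightarrow> nat \<Rightarrow> int poly \<Rightarrow> 'a \<Rightarrow> bool" where
  "homogeneous_value s t m p u \<longleftrightarrow>
    degree p \<le> m \<and> u = (\<Sum>j\<le>m. of_int (coeff p j) * s ^ j * t ^ (m - j))"

lemma homogeneous_value_of_nat: "homogeneous_value s t 0 (of_nat k) (of_nat k)"
  by (simp add: homogeneous_value_def of_nat_poly)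

lemma homogeneous_value_0: "homogeneous_value s t m 0 0"
  by (simp add: homogeneous_value_def)

lemma homogeneous_value_1: "homogeneous_value s t 0 1 1"
  by (simp add: homogeneous_value_def)

lemma homogeneous_value_fst: "homogeneous_value s t 1 [:0, 1:] s"
  by (simp add: homogeneous_value_def)

lemma homogeneous_value_snd: "homogeneous_value s t 1 1 t"
  by (simp add: homogeneous_value_def)

lemma homogeneous_value_add:
  "homogeneous_value s t m p u \<Longrightarrow> homogeneous_value s t m q v
    \<Longrightarrow> homogeneous_value s t m (p + q) (u + v)"
  by (simp add: homogeneous_value_def degree_add_le sum.distrib distrib_right)

lemma homogeneous_value_sum:
  "(\<And>i. i \<in> I \<Longrightarrow> homogeneous_value s t m (p i) (u i))
    \<Longrightarrow> homogeneous_value s t m (sum p I) (sum u I)"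
  by (induction I rule: infinite_finite_induct)
    (auto intro: homogeneous_value_0 homogeneous_value_add)

lemma homogeneous_value_monom:
  assumes "i \<le> m"
  shows "homogeneous_value s t m (monom c i) (of_int c * s ^ i * t ^ (m - i))"
proof -
  have "(\<Sum>j\<le>m. of_int (coeff (monom c i) j) * s ^ j * t ^ (m - j))
      = (\<Sum>j\<le>m. if i = j then of_int c * s ^ j * t ^ (m - j) else 0)"
    by (intro sum.cong) auto
  with assms show ?thesis
    by (simp add: homogeneous_value_def degree_monom_le[THEN le_trans])
qed

lemma homogeneous_value_mult:
  assumes "homogeneous_value s t m p u" "homogeneous_value s t k q v"
  shows "homogeneous_value s t (m + k) (p * q) (u * v)"
proof -
  have p: "p = (\<Sum>i\<le>m. monom (coeff p i) i)" and q: "q = (\<Sum>j\<le>k. monom (coeff q j) j)"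
    using assms by (simp_all add: homogeneous_value_def poly_as_sum_of_monoms')
  have "p * q = (\<Sum>i\<le>m. \<Sum>j\<le>k. monom (coeff p i * coeff q j) (i + j))"
    by (subst p, subst q) (simp add: sum_product mult_monom)
  moreover have "u * v = (\<Sum>i\<le>m. \<Sum>j\<le>k.
      of_int (coeff p i * coeff q j) * s ^ (i + j) * t ^ (m + k - (i + j)))"
  proof -
    have "t ^ (m + k - (i + j)) = t ^ (m - i) * t ^ (k - j)" if "i \<le> m" "j \<le> k" for i j
      using that by (simp flip: power_add)
    then show ?thesis
      using assms by (simp add: homogeneous_value_def sum_product power_add mult_ac)
  qed
  ultimately show ?thesis
    by (simp only:) (intro homogeneous_value_sum homogeneous_value_monom, auto)
qed

lemma homogeneous_value_paired_cd_index:
  assumes q: "homogeneous_value s t 1 q' q" and d: "homogeneous_value s t 1 d' d"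
  shows "homogeneous_value s t ((n - 1) div 2) (paired_cd_index q' d' n) (paired_cd_index q d n)"
proof (induction n rule: less_induct)
  case (less n)
  have optional_q: "homogeneous_value s t (if P then 1 else 0)
      (if P then q' else 1) (if P then q else 1)" for P
    using q by (simp add: homogeneous_value_1)
  consider "n \<le> 1" | (Suc_Suc) m where "n = Suc (Suc m)"
    by (metis One_nat_def Suc_le_mono le0 not0_implies_Suc)
  then show ?case
  proof cases
    case Suc_Suc
    have "homogeneous_value s t (Suc m div 2)
        ((if odd m then q' else 1) * paired_cd_index q' d' (Suc m))
        ((if odd m then q else 1) * paired_cd_index q d (Suc m))"
    proof -
      have degree: "Suc m div 2 = (if odd m then 1 else 0) + (Suc m - 1) div 2" by simp
      show ?thesis unfolding degree
        using less.IH[of "Suc m"] Suc_Suc by (intro homogeneous_value_mult optional_q) simp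
    qed
    moreover have "homogeneous_value s t (Suc m div 2)
        (of_nat (m choose Suc k) * (if odd m \<and> odd k then q' else 1)
          * paired_cd_index q' d' (Suc k) * d' * paired_cd_index q' d' (m - k))
        (of_nat (m choose Suc k) * (if odd m \<and> odd k then q else 1)
          * paired_cd_index q d (Suc k) * d * paired_cd_index q d (m - k))" if "k < m" for k
    proof -
      have degree: "Suc m div 2
          = 0 + (if odd m \<and> odd k then 1 else 0) + (Suc k - 1) div 2 + 1 + (m - k - 1) div 2"
        using that by (auto elim!: evenE oddE)
      show ?thesis unfolding degree
        using less.IH[of "Suc k"] less.IH[of "m - k"] Suc_Suc that
        by (intro homogeneous_value_mult optional_q homogeneous_value_of_nat d) simp_all
    qed
    ultimately show ?thesis
      unfolding Suc_Suc paired_cd_index.simps diff_Suc_1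
      by (intro homogeneous_value_add homogeneous_value_sum) simp_all
  qed (auto simp: homogeneous_value_1 le_Suc_eq)
qed

section \<open>The expansions\<close>

definition gamma_form :: "nat \<Rightarrow> 'a::comm_semiring_1 \<Rightarrow> 'a \<Rightarrow> 'a" where
  "gamma_form n s t = (if even n then s + t else 1) * paired_cd_index (s + t) s n"

lemma A_tilde_eq_gamma_form:
  assumes "n \<ge> 1"
  shows "A_tilde n x y = gamma_form n (x + y) (1 + x * y)"
proof -
  have "A_poly n x y = (if odd n then 1 else x + 1) * paired_cd_index ((x + 1) * (y + 1)) (x + y) n"
    using sum_permutes_alternating[OF assms, of x y 1] by (simp add: A_poly_def)
  moreover have "(x + 1) * (y + 1) = x + y + (1 + x * y)"
    by (simp add: algebra_simps)
  ultimately show ?thesis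
    by (simp add: A_tilde_def gamma_form_def algebra_simps)
qed

lemma A_bar_eq_gamma_form:
  assumes "n \<ge> 1"
  shows "A_bar n x y = gamma_form n (1 + x * y) (x + y)"
proof -
  have "A_hat n x y
      = (if odd n then 1 else x + 1) * paired_cd_index ((x + 1) * (1 + y)) (x * y + 1) n"
    using sum_permutes_alternating[OF assms, of x 1 y] by (simp add: A_hat_def)
  moreover have "(x + 1) * (1 + y) = 1 + x * y + (x + y)"
    by (simp add: algebra_simps)
  ultimately show ?thesis
    by (simp add: A_bar_def gamma_form_def algebra_simps)
qed

lemma homogeneous_value_gamma_form:
  assumes "n \<ge> 1"
  shows "homogeneous_value s t (n div 2) (gamma_form n [:0, 1:] 1) (gamma_form n s t)"
proof -
  have sum: "homogeneous_value s t 1 ([:0, 1:] + 1) (s + t)"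
    by (intro homogeneous_value_add homogeneous_value_fst homogeneous_value_snd)
  have "homogeneous_value s t (if even n then 1 else 0)
      (if even n then [:0, 1:] + 1 else 1) (if even n then s + t else 1)"
    using sum by (simp add: homogeneous_value_1)
  moreover have "n div 2 = (if even n then 1 else 0) + (n - 1) div 2"
    using assms by (auto elim!: evenE oddE)
  ultimately show ?thesis
    unfolding gamma_form_def
    by (simp only:) (intro homogeneous_value_mult homogeneous_value_paired_cd_index sum
        homogeneous_value_fst)
qed

lemma des1_le_half: "des1 n \<sigma> \<le> n div 2"
proof -
  have "des1 n \<sigma> \<le> card ((\<lambda>k. 2 * k + 1) ` {..<n div 2})"
    unfolding des1_def by (rule card_mono) (auto elim!: oddE)
  also have "\<dots> \<le> n div 2"
    using card_image_le[of "{..<n div 2}" "\<lambda>k. 2 * k + 1"] by simp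
  finally show ?thesis .
qed

lemma sum_power_des1_at_zero:
  fixes x :: "'a::comm_semiring_1"
  shows "(\<Sum>\<sigma> | \<sigma> permutes {1..n}. x ^ des1 n \<sigma> * 0 ^ stat \<sigma>) =
    (\<Sum>j=0..n div 2. of_nat (card {\<sigma>. \<sigma> permutes {1..n} \<and> des1 n \<sigma> = j \<and> stat \<sigma> = 0}) * x ^ j)"
proof -
  let ?P = "{\<sigma>. \<sigma> permutes {1..n}}"
  have fin: "finite ?P" by (simp add: finite_permutations)
  have "(\<Sum>\<sigma>\<in>?P. x ^ des1 n \<sigma> * 0 ^ stat \<sigma>) = (\<Sum>\<sigma>\<in>{\<sigma>\<in>?P. stat \<sigma> = 0}. x ^ des1 n \<sigma>)"
    using fin by (intro sum.mono_neutral_cong_right) (auto simp: power_0_left split: if_splits)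
  also have "\<dots> = (\<Sum>j=0..n div 2. \<Sum>\<sigma> | \<sigma> \<in> {\<sigma>\<in>?P. stat \<sigma> = 0} \<and> des1 n \<sigma> = j. x ^ des1 n \<sigma>)"
    using fin des1_le_half by (intro sum.group[symmetric]) auto
  also have "\<dots> = (\<Sum>j=0..n div 2.
      of_nat (card {\<sigma>. \<sigma> permutes {1..n} \<and> des1 n \<sigma> = j \<and> stat \<sigma> = 0}) * x ^ j)"
    by (intro sum.cong refl) (simp add: conj_ac)
  finally show ?thesis .
qed

lemma A_poly_0: "A_poly n x 0 = (\<Sum>j=0..n div 2. of_nat (a_num n j) * x ^ j)"
  unfolding A_poly_def a_num_def by (rule sum_power_des1_at_zero)

lemma A_hat_0: "A_hat n x 0 = (\<Sum>j=0..n div 2. of_nat (a_bar_num n j) * x ^ j)"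
  unfolding A_hat_def a_bar_num_def by (rule sum_power_des1_at_zero)

lemma coeff_sum_of_nat_mult_X_power:
  assumes "j \<le> m"
  shows "coeff (\<Sum>i=0..m. of_nat (g i) * [:0, 1:] ^ i) j = (of_nat (g j) :: int)"
proof -
  have "coeff (\<Sum>i=0..m. of_nat (g i) * [:0, 1:] ^ i) j
      = (\<Sum>i=0..m. if i = j then of_nat (g i) else (0 :: int))"
    by (simp add: coeff_sum of_nat_poly flip: monom_altdef)
  then show ?thesis using assms by simp
qed

lemma coeff_gamma_form:
  assumes "n \<ge> 1" "j \<le> n div 2"
  shows "coeff (gamma_form n [:0, 1:] 1) j = int (a_num n j)"
proof -
  have "gamma_form n [:0, 1:] 1 = A_poly n [:0, 1:] (0 :: int poly)"
    using A_tilde_eq_gamma_form[OF assms(1), of "[:0, 1 :: int:]" 0]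
    by (cases "even n") (simp_all add: A_tilde_def)
  then show ?thesis
    unfolding A_poly_0 by (simp only: coeff_sum_of_nat_mult_X_power[OF assms(2)])
qed

lemma gamma_form_expansion:
  fixes s t :: "'a::comm_ring_1"
  assumes "n \<ge> 1"
  shows "gamma_form n s t = (\<Sum>j=0..n div 2. of_nat (a_num n j) * s ^ j * t ^ (n div 2 - j))"
  using homogeneous_value_gamma_form[OF assms, of s t] coeff_gamma_form[OF assms]
  by (simp add: homogeneous_value_def atLeast0AtMost)

lemma gamma_form_expansion_flip:
  fixes s t :: "'a::comm_ring_1"
  assumes "n \<ge> 1"
  shows "gamma_form n s t
    = (\<Sum>j=0..n div 2. of_nat (a_num n (n div 2 - j)) * t ^ j * s ^ (n div 2 - j))"
  unfolding gamma_form_expansion[OF assms]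
  by (rule sum.reindex_bij_witness[of _ "\<lambda>j. n div 2 - j" "\<lambda>j. n div 2 - j"]) (auto simp: mult_ac)

lemma a_bar_num_eq_a_num:
  assumes "n \<ge> 1" "j \<le> n div 2"
  shows "a_bar_num n j = a_num n (n div 2 - j)"
proof -
  have "(\<Sum>j=0..n div 2. of_nat (a_bar_num n j) * [:0, 1 :: int:] ^ j) = gamma_form n 1 [:0, 1:]"
    using A_bar_eq_gamma_form[OF assms(1), of "[:0, 1 :: int:]" 0]
    by (cases "even n") (simp_all add: A_bar_def A_hat_0)
  also have "\<dots> = (\<Sum>j=0..n div 2. of_nat (a_num n (n div 2 - j)) * [:0, 1:] ^ j)"
    by (simp add: gamma_form_expansion_flip[OF assms(1)])
  finally have "coeff (\<Sum>j=0..n div 2. of_nat (a_bar_num n j) * [:0, 1 :: int:] ^ j) j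
      = coeff (\<Sum>j=0..n div 2. of_nat (a_num n (n div 2 - j)) * [:0, 1:] ^ j) j"
    by (rule arg_cong)
  then show ?thesis
    by (simp only: coeff_sum_of_nat_mult_X_power[OF assms(2)] of_nat_eq_iff)
qed

theorem theorem2p5:
  fixes n :: nat and x y :: "'a::comm_ring_1"
  assumes "n \<ge> 1"
  shows "A_poly n x 0 = (\<Sum>j=0..n div 2. of_nat (a_num n j) * x ^ j) \<and>
    A_hat n x 0 = (\<Sum>j=0..n div 2. of_nat (a_bar_num n j) * x ^ j) \<and>
    A_tilde n x y =
      (\<Sum>j=0..n div 2. of_nat (a_num n j) * (x + y) ^ j * (1 + x * y) ^ (n div 2 - j)) \<and>
    A_bar n x y =
      (\<Sum>j=0..n div 2. of_nat (a_bar_num n j) * (x + y) ^ j * (1 + x * y) ^ (n div 2 - j)) \<and>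
    (\<forall>j\<in>{0..n div 2}. a_bar_num n j = a_num n (n div 2 - j))"
proof (intro conjI ballI)
  show "A_tilde n x y =
      (\<Sum>j=0..n div 2. of_nat (a_num n j) * (x + y) ^ j * (1 + x * y) ^ (n div 2 - j))"
    using assms by (simp only: A_tilde_eq_gamma_form gamma_form_expansion)
  show "A_bar n x y =
      (\<Sum>j=0..n div 2. of_nat (a_bar_num n j) * (x + y) ^ j * (1 + x * y) ^ (n div 2 - j))"
    using assms by (simp add: A_bar_eq_gamma_form gamma_form_expansion_flip a_bar_num_eq_a_num)
qed (use assms in \<open>simp_all add: A_poly_0 A_hat_0 a_bar_num_eq_a_num\<close>)

end
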